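(* Let $n\ge 2$, let $X=\sum_{i=1}^n a_i\,\partial/\partial\theta_i$ be a constant vector field on $T^n$ whose coefficients $a_1,\dots,a_n\in\mathbb{R}$ are independent over $\mathbb{Q}$, and let $\phi$ be the flow on $T^n$ generated by $X$. Then $\ker\rho_\phi\cong T^n$ (as groups).
   Context: $T^n=\mathbb{R}^n/\mathbb{Z}^n$ with coordinates $\theta_i=x_i\bmod 1$. $\mathrm{Diff}(T^n)$ is the group of $C^\infty$ diffeomorphisms of $T^n$. Real numbers $a_1,\dots,a_n$ are independent over $\mathbb{Q}$ if $\sum_j m_ja_j=0$ with $m_j\in\mathbb{Z}$ implies all $m_j=0$. For a flow $\phi$ generated by $X$, $F_\phi=\{\phi_t:t\in\mathbb{R}\}$ and $S_\phi$ is the normalizer of $F_\phi$ in $\mathrm{Diff}(T^n)$. For $R\in\mathrm{Diff}(T^n)$, $R_*X=\mathbf{T}R\circ X\circ R^{-1}$, where $\mathbf{T}$ is the tangent functor. It is known that $R\in S_\phi$ if and only if there is a unique $\alpha\in\mathbb{R}^*=\mathbb{R}\setminus\{0\}$ with $R_*X=\alpha X$ (equivalently $R\phi_t=\phi_{\alpha t}R$ for all $t$); the homomorphism $\rho_\phi:S_\phi\to\mathbb{R}^*$ sends $R$ to this $\alpha$. *)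

theory Defs
  imports "HOL-Analysis.Analysis" "HOL-Algebra.Group_Action"
begin

definition lattice_cong :: "real^'n::finite \<Rightarrow> real^'n \<Rightarrow> bool"
  where "lattice_cong x y \<longleftrightarrow> (\<forall>i. x $ i - y $ i \<in> \<int>)"

quotient_type (overloaded) 'n torus = "real^'n::finite" / lattice_cong
  morphisms rep_torus torus_proj
proof (rule equivpI)
  show "reflp (lattice_cong :: real^'n \<Rightarrow> _)"
    by (auto simp: reflp_def lattice_cong_def)
  show "symp (lattice_cong :: real^'n \<Rightarrow> _)"
  proof (rule sympI)
    fix x y :: "real^'n"
    assume "lattice_cong x y"
    then have "- (x $ i - y $ i) \<in> \<int>" for i
      unfolding lattice_cong_def by (blast intro: Ints_minus)
    then show "lattice_cong y x"
      by (simp add: lattice_cong_def)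
  qed
  show "transp (lattice_cong :: real^'n \<Rightarrow> _)"
  proof (rule transpI)
    fix x y z :: "real^'n"
    assume "lattice_cong x y" "lattice_cong y z"
    then have "(x $ i - y $ i) + (y $ i - z $ i) \<in> \<int>" for i
      unfolding lattice_cong_def by (blast intro: Ints_add)
    then show "lattice_cong x z"
      by (simp add: lattice_cong_def)
  qed
qed

instantiation torus :: (finite) ab_group_add
begin

lift_definition zero_torus :: "'a torus" is "0" .

lift_definition plus_torus :: "'a torus \<Rightarrow> 'a torus \<Rightarrow> 'a torus" is "(+)"
proof -
  fix x y z w :: "real^'a"
  assume "lattice_cong x y" "lattice_cong z w"
  then have "(x $ i - y $ i) + (z $ i - w $ i) \<in> \<int>" for i
    unfolding lattice_cong_def by (blast intro: Ints_add)
  then show "lattice_cong (x + z) (y + w)"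
    by (simp add: lattice_cong_def add_diff_add)
qed

lift_definition uminus_torus :: "'a torus \<Rightarrow> 'a torus" is "uminus"
proof -
  fix x y :: "real^'a"
  assume "lattice_cong x y"
  then have "- (x $ i - y $ i) \<in> \<int>" for i
    unfolding lattice_cong_def by (blast intro: Ints_minus)
  then show "lattice_cong (- x) (- y)"
    by (simp add: lattice_cong_def)
qed

lift_definition minus_torus :: "'a torus \<Rightarrow> 'a torus \<Rightarrow> 'a torus" is "(-)"
proof -
  fix x y z w :: "real^'a"
  assume "lattice_cong x y" "lattice_cong z w"
  then have "(x $ i - y $ i) - (z $ i - w $ i) \<in> \<int>" for i
    unfolding lattice_cong_def by (blast intro: Ints_diff)
  moreover have "(x - z) $ i - (y - w) $ i = (x $ i - y $ i) - (z $ i - w $ i)" for i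
    by simp
  ultimately show "lattice_cong (x - z) (y - w)"
    unfolding lattice_cong_def by presburger
qed

instance
proof
  fix a b c :: "'a torus"
  show "a + b + c = a + (b + c)"
    by transfer (simp add: lattice_cong_def)
  show "a + b = b + a"
    by transfer (simp add: lattice_cong_def)
  show "0 + a = a"
    by transfer (simp add: lattice_cong_def)
  show "- a + a = 0"
    by transfer (simp add: lattice_cong_def)
  show "a - b = a + - b"
    by transfer (simp add: lattice_cong_def)
qed

end

definition torus_group :: "'n::finite torus monoid"
  where "torus_group = \<lparr>carrier = UNIV, monoid.mult = (+), one = 0\<rparr>"

(* The inverse of the projection on the half-open unit cube centred at x.  On the open cube it is
   a coordinate chart of the torus, and these charts form its standard smooth atlas. *)
lift_definition torus_chart :: "real^'n::finite \<Rightarrow> 'n torus \<Rightarrow> real^'n"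
  is "\<lambda>x y. \<chi> i. x $ i - 1/2 + frac (y $ i - x $ i + 1/2)"
proof -
  fix x y y' :: "real^'n"
  assume "lattice_cong y y'"
  then have *: "y $ i - y' $ i \<in> \<int>" for i
    by (simp add: lattice_cong_def)
  have "frac (y $ i - x $ i + 1/2) = frac (y' $ i - x $ i + 1/2)" for i
  proof -
    obtain k where "y $ i - y' $ i = of_int k"
      using * Ints_cases by blast
    then have "y $ i - x $ i + 1/2 = (y' $ i - x $ i + 1/2) + of_int k"
      by simp
    then show ?thesis
      unfolding frac_def by (simp only: floor_add_int [symmetric] of_int_add)
  qed
  then show "(\<chi> i. x $ i - 1/2 + frac (y $ i - x $ i + 1/2))
    = (\<chi> i. x $ i - 1/2 + frac (y' $ i - x $ i + 1/2))"
    by simp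
qed

lemma torus_proj_chart: "torus_proj (torus_chart x p) = p"
proof (transfer)
  fix x y :: "real^'n"
  have "x $ i - 1/2 + frac (y $ i - x $ i + 1/2) - y $ i = - of_int \<lfloor>y $ i - x $ i + 1/2\<rfloor>" for i
    by (simp add: frac_def)
  then show "lattice_cong (\<chi> i. x $ i - 1/2 + frac (y $ i - x $ i + 1/2)) y"
    by (simp add: lattice_cong_def)
qed

primrec Ck_on :: "nat \<Rightarrow> ('a::real_normed_vector \<Rightarrow> 'b::real_normed_vector) \<Rightarrow> 'a set \<Rightarrow> bool"
  where
    "Ck_on 0 f S \<longleftrightarrow> continuous_on S f"
  | "Ck_on (Suc k) f S \<longleftrightarrow> (\<forall>x\<in>S. f differentiable (at x)) \<and>
       (\<forall>v. Ck_on k (\<lambda>x. frechet_derivative f (at x) v) S)"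

(* Meant for open S and a finite-dimensional domain, where f is C^(k+1) iff it is differentiable with
   all directional derivatives C^k. *)
definition smooth_on :: "('a::real_normed_vector \<Rightarrow> 'b::real_normed_vector) \<Rightarrow> 'a set \<Rightarrow> bool"
  where "smooth_on f S \<longleftrightarrow> (\<forall>k. Ck_on k f S)"

(* The expression of f in the charts centred at rep_torus p and rep_torus (f p), extended to all
   of the covering space; only its germ at rep_torus p matters below. *)
definition local_expr :: "('n::finite torus \<Rightarrow> 'n torus) \<Rightarrow> 'n torus \<Rightarrow> real^'n \<Rightarrow> real^'n"
  where "local_expr f p = torus_chart (rep_torus (f p)) \<circ> f \<circ> torus_proj"

definition smooth_torus_map :: "('n::finite torus \<Rightarrow> 'n torus) \<Rightarrow> bool"
  where "smooth_torus_map f \<longleftrightarrow>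
    (\<forall>p. \<exists>U. open U \<and> rep_torus p \<in> U \<and> smooth_on (local_expr f p) U)"

definition Diff_torus :: "('n::finite torus \<Rightarrow> 'n torus) monoid"
  where "Diff_torus =
    \<lparr>carrier = {f. bij f \<and> smooth_torus_map f \<and> smooth_torus_map (inv_into UNIV f)},
     monoid.mult = (\<circ>), one = id\<rparr>"

(* The tangent bundle is trivialised by the coordinate fields: (p, v) stands for the tangent vector
   at p with components v in the basis d/d(theta_i).  The projection is translation invariant, so
   the components do not depend on the chart used. *)
type_synonym 'n torus_tangent = "'n torus \<times> (real^'n)"

type_synonym 'n torus_field = "'n torus \<Rightarrow> 'n torus_tangent"

definition tangent_map ::
    "('n::finite torus \<Rightarrow> 'n torus) \<Rightarrow> 'n torus_tangent \<Rightarrow> 'n torus_tangent"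
  where "tangent_map f =
    (\<lambda>(p, v). (f p, frechet_derivative (local_expr f p) (at (rep_torus p)) v))"

definition constant_field :: "real^'n::finite \<Rightarrow> 'n torus_field"
  where "constant_field a = (\<lambda>p. (p, a))"

definition scale_field :: "real \<Rightarrow> 'n::finite torus_field \<Rightarrow> 'n torus_field"
  where "scale_field \<alpha> X = (\<lambda>p. (fst (X p), \<alpha> *\<^sub>R snd (X p)))"

definition pushforward ::
    "('n::finite torus \<Rightarrow> 'n torus) \<Rightarrow> 'n torus_field \<Rightarrow> 'n torus_field"
  where "pushforward R X = tangent_map R \<circ> X \<circ> inv_into UNIV R"

definition has_velocity ::
    "(real \<Rightarrow> 'n::finite torus) \<Rightarrow> 'n torus_tangent \<Rightarrow> real \<Rightarrow> bool"
  where "has_velocity \<gamma> w t \<longleftrightarrow> fst w = \<gamma> t \<and>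
    ((torus_chart (rep_torus (\<gamma> t)) \<circ> \<gamma>) has_vector_derivative snd w) (at t)"

definition flow_generated_by ::
    "'n::finite torus_field \<Rightarrow> (real \<Rightarrow> 'n torus \<Rightarrow> 'n torus) \<Rightarrow> bool"
  where "flow_generated_by X \<phi> \<longleftrightarrow>
    (\<forall>p. \<phi> 0 p = p) \<and> (\<forall>p t. has_velocity (\<lambda>s. \<phi> s p) (X (\<phi> t p)) t)"

definition rational_independent :: "real^'n::finite \<Rightarrow> bool"
  where "rational_independent a \<longleftrightarrow>
    (\<forall>m :: 'n \<Rightarrow> int. (\<Sum>j\<in>UNIV. of_int (m j) * a $ j) = 0 \<longrightarrow> (\<forall>j. m j = 0))"

definition mult_real_group :: "real monoid"
  where "mult_real_group = \<lparr>carrier = UNIV - {0}, monoid.mult = (*), one = 1\<rparr>"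

definition flow_normalizer_group ::
    "(real \<Rightarrow> 'n::finite torus \<Rightarrow> 'n torus) \<Rightarrow> ('n torus \<Rightarrow> 'n torus) monoid"
  where "flow_normalizer_group \<phi> = Diff_torus\<lparr>carrier := normalizer Diff_torus (range \<phi>)\<rparr>"

(* The homomorphism rho of the flow generated by X, as a function of X; meaningful for R in the
   normalizer of the flow. *)
definition multiplier :: "'n::finite torus_field \<Rightarrow> ('n torus \<Rightarrow> 'n torus) \<Rightarrow> real"
  where "multiplier X R = (THE \<alpha>. \<alpha> \<noteq> 0 \<and> pushforward R X = scale_field \<alpha> X)"

definition multiplier_kernel_group ::
    "'n::finite torus_field \<Rightarrow> (real \<Rightarrow> 'n torus \<Rightarrow> 'n torus) \<Rightarrow> ('n torus \<Rightarrow> 'n torus) monoid"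
  where "multiplier_kernel_group X \<phi> = (flow_normalizer_group \<phi>)
    \<lparr>carrier := kernel (flow_normalizer_group \<phi>) mult_real_group (multiplier X)\<rparr>"

end

(* The characters exp(2 pi i theta_j) separate points of the torus and pull smooth maps back to
   globally defined functions, so differential equations on the torus can be solved without changing
   charts; in particular the flow is phi_t(p) = p + t a.  If R normalizes the flow, then
   R(p + t a) = R(p) + s(t) a; differentiating at t = 0 shows that v = DR_p(a) does not depend on p,
   whence R(p + t a) = R(p) + t v.  So every t v is congruent to some multiple of a modulo the
   lattice, and since the lattice is countable, v is a multiple of a, which makes rho(R) well defined.
   If rho(R) = 1, then R(p) - p is constant along the orbits of the flow, which are dense by
   Kronecker's theorem, so R is a translation. *)

theory Submission
  imports Defs
begin

section \<open>Characters and charts of the torus\<close>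

lift_definition torus_char :: "'n::finite \<Rightarrow> 'n torus \<Rightarrow> complex"
  is "\<lambda>i x. cis (2 * pi * x $ i)"
proof -
  fix i and x y :: "real^'n"
  assume "lattice_cong x y"
  then have "x $ i - y $ i \<in> \<int>"
    by (simp add: lattice_cong_def)
  then have "cis (2 * pi * (x $ i - y $ i)) = 1"
    by (rule cis_multiple_2pi)
  then show "cis (2 * pi * x $ i) = cis (2 * pi * y $ i)"
    by (simp add: right_diff_distrib flip: cis_divide)
qed

lemma cis_2pi_eq_iff: "cis (2 * pi * x) = cis (2 * pi * y) \<longleftrightarrow> x - y \<in> \<int>"
proof
  assume "cis (2 * pi * x) = cis (2 * pi * y)"
  then have "cis (2 * pi * (x - y)) = 1"
    by (simp add: right_diff_distrib flip: cis_divide)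
  then have "exp (\<i> * of_real (2 * pi * (x - y))) = 1"
    by (simp add: cis_conv_exp)
  then obtain n :: int where "2 * pi * (x - y) = of_int (2 * n) * pi"
    unfolding exp_eq_1 by auto
  then have "x - y = of_int n"
    by simp
  then show "x - y \<in> \<int>"
    by simp
next
  assume "x - y \<in> \<int>"
  then have "cis (2 * pi * (x - y)) = 1"
    by (rule cis_multiple_2pi)
  then show "cis (2 * pi * x) = cis (2 * pi * y)"
    by (simp add: right_diff_distrib flip: cis_divide)
qed

lemma torus_proj_rep [simp]: "torus_proj (rep_torus p) = p"
  by (rule Quotient3_abs_rep [OF Quotient3_torus])

lemma torus_proj_eq_iff: "torus_proj x = torus_proj y \<longleftrightarrow> (\<forall>i. x $ i - y $ i \<in> \<int>)"
  by (simp add: torus.abs_eq_iff lattice_cong_def)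

lemma torus_char_proj [simp]: "torus_char i (torus_proj x) = cis (2 * pi * x $ i)"
  by (rule torus_char.abs_eq)

lemma torus_char_chart: "torus_char i p = cis (2 * pi * torus_chart x p $ i)"
  using torus_char_proj [of i "torus_chart x p"] by (simp add: torus_proj_chart)

lemma torus_char_add: "torus_char i (p + q) = torus_char i p * torus_char i q"
  by transfer (simp add: cis_mult ring_distribs)

lemma torus_char_nonzero [simp]: "torus_char i p \<noteq> 0"
  by transfer simp

lemma torus_char_eqI:
  assumes "\<And>i. torus_char i p = torus_char i q"
  shows "p = q"
  using assms
  by transfer (simp add: cis_2pi_eq_iff lattice_cong_def)

lemma torus_proj_add: "torus_proj (x + y) = torus_proj x + torus_proj y"
  by (simp add: plus_torus.abs_eq)

lemma torus_proj_0 [simp]: "torus_proj 0 = 0"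
  by (simp add: zero_torus_def)

text \<open>The hypothesis puts \<open>y $ i - x $ i + 1/2\<close> strictly between 0 and 1, where
  \<open>frac\<close> is the identity. This is what makes charts computable near their
  centres.\<close>

lemma torus_chart_proj_near:
  assumes "\<And>i. \<bar>y $ i - x $ i\<bar> < 1/2"
  shows "torus_chart x (torus_proj y) = y"
proof -
  have "frac (y $ i - x $ i + 1/2) = y $ i - x $ i + 1/2" for i
    using assms [of i] by (simp only: frac_eq abs_less_iff) linarith
  then show ?thesis
    by (simp add: torus_chart.abs_eq vec_eq_iff)
qed

lemma torus_chart_self [simp]: "torus_chart (rep_torus p) p = rep_torus p"
  using torus_chart_proj_near [of "rep_torus p" "rep_torus p"] by simp

section \<open>Derivatives of characters and the flow of a constant field\<close>

lemma has_derivative_cis_2pi: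
  fixes f :: "'a::real_normed_vector \<Rightarrow> real"
  assumes "(f has_derivative f') (at x)"
  shows "((\<lambda>x. cis (2 * pi * f x)) has_derivative
    (\<lambda>v. 2 * pi * \<i> * of_real (f' v) * cis (2 * pi * f x))) (at x)"
proof -
  have "((\<lambda>x. \<i> * of_real (2 * pi * f x)) has_derivative (\<lambda>v. \<i> * of_real (2 * pi * f' v))) (at x)"
    by (intro has_derivative_mult_right has_derivative_of_real assms)
  from has_derivative_compose [OF this DERIV_exp [unfolded has_field_derivative_def]]
  show ?thesis
    by (simp add: cis_conv_exp mult_ac)
qed

lemma has_derivative_cis_2pi_nth:
  fixes f :: "'a::real_normed_vector \<Rightarrow> real^'n::finite"
  assumes "(f has_derivative f') (at x)"
  shows "((\<lambda>x. cis (2 * pi * f x $ i)) has_derivative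
    (\<lambda>v. 2 * pi * \<i> * of_real (f' v $ i) * cis (2 * pi * f x $ i))) (at x)"
  using has_derivative_cis_2pi [OF bounded_linear.has_derivative [OF bounded_linear_vec_nth assms]] .

text \<open>Integrating factor: the product of \<open>g\<close> with the inverse exponential has
  derivative zero, so it keeps its value at time 0. No general uniqueness theorem for differential
  equations is involved.\<close>

lemma character_ode_solution:
  fixes g :: "real \<Rightarrow> complex"
  assumes g: "\<And>t. (g has_vector_derivative 2 * pi * \<i> * of_real c * g t) (at t)"
  shows "g t = g 0 * cis (2 * pi * c * t)"
proof -
  let ?e = "\<lambda>t. cis (2 * pi * (- c * t))"
  have e: "(?e has_vector_derivative - (2 * pi * \<i> * of_real c) * ?e t) (at t)" for t
  proof -
    have "((\<lambda>t. - c * t) has_derivative (\<lambda>h. - c * h)) (at t)"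
      by (intro has_derivative_mult_right has_derivative_ident)
    from has_derivative_cis_2pi [OF this] show ?thesis
      by (simp add: has_vector_derivative_def scaleR_conv_of_real [where 'a = complex] mult_ac)
  qed
  have "((\<lambda>t. g t * ?e t) has_vector_derivative 0) (at t)" for t
    using has_vector_derivative_mult [OF g [of t] e [of t]] by (simp add: algebra_simps)
  then obtain k where k: "\<And>t. g t * ?e t = k"
    using has_vector_derivative_zero_constant [of UNIV] by auto
  have "g t = g t * (?e t * cis (2 * pi * c * t))"
    by (simp add: cis_mult)
  also have "\<dots> = k * cis (2 * pi * c * t)"
    by (metis k mult.assoc)
  also have "k = g 0"
    using k [of 0] by simp
  finally show ?thesis .
qed

text \<open>By \<open>torus_char_chart\<close> a character can be read off from the coordinates in
  any chart. The chart centred at the moving point therefore disappears, and the velocity becomes a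
  condition on one globally defined function of time.\<close>

lemma has_velocity_torus_char:
  assumes "has_velocity \<gamma> w t"
  shows "((\<lambda>s. torus_char i (\<gamma> s)) has_vector_derivative
    2 * pi * \<i> * of_real (snd w $ i) * torus_char i (\<gamma> t)) (at t)"
proof -
  let ?f = "\<lambda>s. torus_chart (rep_torus (\<gamma> t)) (\<gamma> s)"
  have "(?f has_derivative (\<lambda>h. h *\<^sub>R snd w)) (at t)"
    using assms by (simp add: has_velocity_def has_vector_derivative_def o_def)
  from has_derivative_cis_2pi_nth [OF this, of i] show ?thesis
    unfolding has_vector_derivative_def torus_char_chart [symmetric]
    by (simp add: scaleR_conv_of_real [where 'a = complex] mult.commute mult.left_commute)
qed

lemma flow_of_constant_field:
  assumes "flow_generated_by (constant_field a) \<phi>"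
  shows "\<phi> t p = p + torus_proj (t *\<^sub>R a)"
proof (rule torus_char_eqI)
  fix i
  have "torus_char i (\<phi> t p) = torus_char i (\<phi> 0 p) * cis (2 * pi * (a $ i) * t)"
  proof (rule character_ode_solution)
    fix t
    have "has_velocity (\<lambda>s. \<phi> s p) (constant_field a (\<phi> t p)) t"
      using assms by (simp add: flow_generated_by_def)
    from has_velocity_torus_char [OF this]
    show "((\<lambda>t. torus_char i (\<phi> t p)) has_vector_derivative
      2 * pi * \<i> * of_real (a $ i) * torus_char i (\<phi> t p)) (at t)"
      by (simp add: constant_field_def)
  qed
  moreover have "\<phi> 0 p = p"
    using assms by (simp add: flow_generated_by_def)
  ultimately show "torus_char i (\<phi> t p) = torus_char i (p + torus_proj (t *\<^sub>R a))"
    by (simp add: torus_char_add mult_ac)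
qed

section \<open>Smooth torus maps along lines\<close>

lemma smooth_torus_map_has_derivative:
  assumes "smooth_torus_map f"
  shows "(local_expr f p has_derivative frechet_derivative (local_expr f p) (at (rep_torus p)))
    (at (rep_torus p))"
proof -
  obtain U where "rep_torus p \<in> U" "smooth_on (local_expr f p) U"
    using assms by (auto simp: smooth_torus_map_def)
  then have "Ck_on (Suc 0) (local_expr f p) U"
    unfolding smooth_on_def by blast
  then show ?thesis
    using \<open>rep_torus p \<in> U\<close> by (simp add: frechet_derivative_works)
qed

lemma smooth_torus_map_char_derivative:
  assumes "smooth_torus_map f"
  shows "((\<lambda>x. torus_char i (f (torus_proj x))) has_derivative
    (\<lambda>v. 2 * pi * \<i> * of_real (snd (tangent_map f (p, v)) $ i) * torus_char i (f p)))
    (at (rep_torus p))"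
proof -
  have expr: "torus_char i (f (torus_proj x)) = cis (2 * pi * local_expr f p x $ i)" for x
    by (simp add: local_expr_def torus_char_chart [symmetric])
  show ?thesis
    using has_derivative_cis_2pi_nth [OF smooth_torus_map_has_derivative [OF assms, of p], of i]
    unfolding expr [symmetric] by (simp add: tangent_map_def)
qed

lemma torus_char_line_derivative:
  assumes "smooth_torus_map f"
  shows "((\<lambda>t. torus_char i (f (p + torus_proj (t *\<^sub>R a)))) has_vector_derivative
    2 * pi * \<i> * of_real (snd (tangent_map f (p + torus_proj (t *\<^sub>R a), a)) $ i)
      * torus_char i (f (p + torus_proj (t *\<^sub>R a)))) (at t)"
proof -
  define q where "q = p + torus_proj (t *\<^sub>R a)"
  have D: "linear (frechet_derivative (local_expr f q) (at (rep_torus q)))"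
    using smooth_torus_map_has_derivative [OF assms] by (rule has_derivative_linear)
  \<comment> \<open>The derivative of \<open>f\<close> at \<open>q\<close> is taken at the
    representative \<open>rep_torus q\<close>, which need not lie on the given lift of the line. The
    line is therefore lifted afresh, so that it passes through \<open>rep_torus q\<close> at time
    \<open>t\<close>.\<close>
  have line: "torus_proj (rep_torus q + (s - t) *\<^sub>R a) = p + torus_proj (s *\<^sub>R a)" for s
  proof -
    have "torus_proj (rep_torus q + (s - t) *\<^sub>R a) = q + torus_proj ((s - t) *\<^sub>R a)"
      by (simp only: torus_proj_add torus_proj_rep)
    also have "\<dots> = p + torus_proj (t *\<^sub>R a + (s - t) *\<^sub>R a)"
      by (simp only: torus_proj_add q_def add.assoc)
    finally show ?thesis
      by (simp flip: scaleR_left_distrib)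
  qed
  have "((\<lambda>s. rep_torus q + (s - t) *\<^sub>R a) has_derivative (\<lambda>h. h *\<^sub>R a)) (at t)"
    by (auto intro!: derivative_eq_intros)
  moreover have "((\<lambda>x. torus_char i (f (torus_proj x))) has_derivative
    (\<lambda>v. 2 * pi * \<i> * of_real (snd (tangent_map f (q, v)) $ i) * torus_char i (f q)))
    (at (rep_torus q + (t - t) *\<^sub>R a))"
    using smooth_torus_map_char_derivative [OF assms] by simp
  ultimately have "((\<lambda>s. torus_char i (f (torus_proj (rep_torus q + (s - t) *\<^sub>R a))))
      has_derivative
    (\<lambda>h. 2 * pi * \<i> * of_real (snd (tangent_map f (q, h *\<^sub>R a)) $ i) * torus_char i (f q)))
    (at t)"
    by (rule has_derivative_compose)
  then show ?thesis
    unfolding line has_vector_derivative_def q_def [symmetric]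
    by (simp add: tangent_map_def linear_scale [OF D] scaleR_conv_of_real [where 'a = complex] mult_ac)
qed

text \<open>Since \<open>v\<close> is the same at all points, each character of the image curve
  satisfies a linear equation with constant coefficient, which \<open>character_ode_solution\<close>
  solves.\<close>

lemma smooth_torus_map_along_line:
  assumes "smooth_torus_map f"
    and "\<And>p. snd (tangent_map f (p, a)) = v"
  shows "f (p + torus_proj (t *\<^sub>R a)) = f p + torus_proj (t *\<^sub>R v)"
proof (rule torus_char_eqI)
  fix i
  have "torus_char i (f (p + torus_proj (t *\<^sub>R a))) =
    torus_char i (f (p + torus_proj (0 *\<^sub>R a))) * cis (2 * pi * (v $ i) * t)"
    by (rule character_ode_solution)
      (rule torus_char_line_derivative [OF assms(1), where a = a, unfolded assms(2)])
  then show "torus_char i (f (p + torus_proj (t *\<^sub>R a))) = torus_char i (f p + torus_proj (t *\<^sub>R v))"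
    by (simp add: torus_char_add mult_ac)
qed

text \<open>Differentiability, and with it continuity, is available at the representatives chosen by
  \<open>rep_torus\<close>. The lifted function is periodic under the lattice, so a lattice
  translation by \<open>y - x\<close> carries continuity to every other point.\<close>

lemma smooth_torus_map_char_continuous:
  assumes "smooth_torus_map f"
  shows "continuous_on UNIV (\<lambda>x. torus_char i (f (torus_proj x)))"
  unfolding continuous_on_eq_continuous_at [OF open_UNIV]
proof
  fix x :: "real^'a"
  define y where "y = rep_torus (torus_proj x)"
  have "torus_proj y = torus_proj x"
    by (simp add: y_def)
  then have "torus_proj (y - x) = torus_proj 0"
    unfolding torus_proj_eq_iff by simp
  then have shift: "torus_proj (z + (y - x)) = torus_proj z" for z
    unfolding torus_proj_add by simp
  have "isCont (\<lambda>x. torus_char i (f (torus_proj x))) y"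
    unfolding y_def
    by (rule has_derivative_continuous [OF smooth_torus_map_char_derivative [OF assms]])
  then have "isCont (\<lambda>x. torus_char i (f (torus_proj x))) (x + (y - x))"
    by simp
  then have "isCont (\<lambda>z. torus_char i (f (torus_proj (z + (y - x))))) x"
    by (rule isCont_o2 [where f = "\<lambda>z. z + (y - x)", rotated]) (intro continuous_intros)
  then show "isCont (\<lambda>x. torus_char i (f (torus_proj x))) x"
    unfolding shift .
qed

section \<open>Rational independence and density of the flow lines\<close>

lemma rational_independent_inj:
  assumes "rational_independent a"
  shows "inj (($) a)"
proof (rule injI, rule ccontr)
  fix i j
  assume eq: "a $ i = a $ j" and "i \<noteq> j"
  \<comment> \<open>Equal coefficients at \<open>i\<close> and \<open>j\<close> would give the
    integer relation with coefficient 1 at \<open>i\<close> and -1 at \<open>j\<close>.\<close>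
  define m :: "'a \<Rightarrow> int" where "m = (\<lambda>k. of_bool (k = i) - of_bool (k = j))"
  have "of_int (m k) * a $ k = (if k = i then a $ i else 0) - (if k = j then a $ j else 0)" for k
    by (simp add: m_def)
  then have "(\<Sum>k\<in>UNIV. of_int (m k) * a $ k) = 0"
    by (simp add: sum_subtractf eq)
  then have "m i = 0"
    using assms by (simp add: rational_independent_def)
  then show False
    using \<open>i \<noteq> j\<close> by (simp add: m_def)
qed

lemma rational_independent_nonzero:
  assumes "rational_independent a"
  shows "a $ i \<noteq> 0"
proof
  assume "a $ i = 0"
  then have "of_int (of_bool (k = i) :: int) * a $ k = 0" for k
    by simp
  then have "(\<Sum>k\<in>UNIV. of_int (of_bool (k = i) :: int) * a $ k) = 0"
    by (simp only: sum.neutral_const)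
  with assms have "\<forall>k. (of_bool (k = i) :: int) = 0"
    unfolding rational_independent_def by (elim allE [where x = "\<lambda>k. of_bool (k = i)"]) simp
  then show False
    by simp
qed

text \<open>Translates independence of a family into independence of the set of its values over the
  integers, the form that \<open>Kronecker_thm_1\<close> expects. The family is injective, so
  nothing is lost in passing to the set.\<close>

lemma rational_independent_imp_independent:
  assumes "rational_independent a"
  shows "module.independent (\<lambda>r. (*) (real_of_int r)) (range (($) a))"
proof -
  interpret module "\<lambda>r. (*) (real_of_int r)"
    by (simp add: module.intro distrib_left mult.commute)
  show ?thesis
    unfolding independent_explicit_module
  proof (intro allI impI)
    fix t and u :: "real \<Rightarrow> int" and v
    assume "finite t" and t: "t \<subseteq> range (($) a)" and sum: "(\<Sum>v\<in>t. of_int (u v) * v) = 0"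
      and "v \<in> t"
    \<comment> \<open>The coefficients, given on values, are pulled back to indices and extended by
      0, because \<open>rational_independent\<close> speaks of sums over all coordinates.\<close>
    define m where "m = (\<lambda>j. if a $ j \<in> t then u (a $ j) else 0)"
    have "(\<Sum>j\<in>UNIV. of_int (m j) * a $ j) = (\<Sum>j | a $ j \<in> t. of_int (u (a $ j)) * a $ j)"
      by (rule sum.mono_neutral_cong_right) (auto simp: m_def)
    also have "\<dots> = (\<Sum>v\<in>t. of_int (u v) * v)"
    proof (rule sum.reindex_cong [symmetric, where l = "($) a"])
      show "inj_on (($) a) {j. a $ j \<in> t}"
        using rational_independent_inj [OF assms] by (rule inj_on_subset) simp
      show "t = ($) a ` {j. a $ j \<in> t}"
        using t by auto
    qed simp
    finally have "\<forall>j. m j = 0"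
      using assms sum by (simp add: rational_independent_def)
    moreover obtain j where "v = a $ j"
      using t \<open>v \<in> t\<close> by auto
    ultimately show "u v = 0"
      using \<open>v \<in> t\<close> by (auto simp: m_def split: if_splits)
  qed
qed

text \<open>Kronecker's theorem with a real time parameter. Density is stated in the covering space:
  the point \<open>z\<close> near \<open>y\<close> is a lift of a point of the line, so no topology
  on the quotient is needed.\<close>

lemma torus_line_dense:
  fixes a y :: "real^'n::finite"
  assumes "rational_independent a" and "\<epsilon> > 0"
  obtains t z where "torus_proj z = torus_proj (t *\<^sub>R a)" "dist z y < \<epsilon>"
proof -
  obtain h where h: "bij_betw h {..<CARD('n)} (UNIV :: 'n set)"
    using ex_bij_betw_nat_finite [of "UNIV :: 'n set"] by (auto simp: atLeast0LessThan)
  define \<theta> where "\<theta> = (\<lambda>i. a $ h i)"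
  have "\<theta> ` {..<CARD('n)} = range (($) a)"
    using bij_betw_imp_surj_on [OF h] by (simp add: \<theta>_def flip: image_image)
  then have "module.independent (\<lambda>r. (*) (real_of_int r)) (\<theta> ` {..<CARD('n)})"
    using rational_independent_imp_independent [OF assms(1)] by simp
  moreover have "inj_on \<theta> {..<CARD('n)}"
    using bij_betw_imp_inj_on [OF h] rational_independent_inj [OF assms(1)]
    by (auto simp: \<theta>_def inj_on_def)
  \<comment> \<open>The tolerance is split evenly among the coordinates, since the distance will be
    bounded by the sum of the coordinate errors.\<close>
  moreover have "\<epsilon> / CARD('n) > 0"
    using assms(2) by simp
  ultimately have "\<exists>t k. \<forall>i<CARD('n). \<bar>t * \<theta> i - of_int (k i) - y $ h i\<bar> < \<epsilon> / CARD('n)"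
    by (rule Kronecker_thm_1 [where \<alpha> = "\<lambda>i. y $ h i"]) blast
  then obtain t k
    where tk: "\<And>i. i < CARD('n) \<Longrightarrow> \<bar>t * \<theta> i - of_int (k i) - y $ h i\<bar> < \<epsilon> / CARD('n)"
    by blast
  define g where "g = the_inv_into {..<CARD('n)} h"
  have g: "g i < CARD('n)" "h (g i) = i" for i
    using bij_betwE [OF bij_betw_the_inv_into [OF h]] f_the_inv_into_f_bij_betw [OF h]
    by (simp_all add: g_def)
  \<comment> \<open>Subtracting Kronecker's integers from \<open>t *\<^sub>R a\<close> moves it
    close to \<open>y\<close> without changing its image in the torus.\<close>
  define z :: "real^'n" where "z = (\<chi> i. t * a $ i - of_int (k (g i)))"
  have "\<bar>(z - y) $ i\<bar> < \<epsilon> / CARD('n)" for i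
    using tk [OF g(1) [of i]] by (simp add: z_def \<theta>_def g(2))
  then have "(\<Sum>i\<in>UNIV. \<bar>(z - y) $ i\<bar>) < (\<Sum>i\<in>(UNIV :: 'n set). \<epsilon> / CARD('n))"
    by (intro sum_strict_mono) auto
  then have "dist z y < \<epsilon>"
    using norm_le_l1_cart [of "z - y"] by (simp add: dist_norm)
  moreover have "torus_proj z = torus_proj (t *\<^sub>R a)"
    by (simp add: torus_proj_eq_iff z_def)
  ultimately show thesis
    by (rule that [rotated])
qed

text \<open>The displacement of \<open>f\<close> is constant on the orbit of 0. Its characters are
  continuous on the covering space, so the set where they take their value at 0 is closed; as it
  contains the dense set of lifts of that orbit, it contains every representative.\<close>

lemma smooth_torus_map_commuting_with_line:
  assumes "rational_independent a"
    and "smooth_torus_map f"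
    and "\<And>p t. f (p + torus_proj (t *\<^sub>R a)) = f p + torus_proj (t *\<^sub>R a)"
  shows "f p = p + f 0"
proof (rule torus_char_eqI)
  fix i
  \<comment> \<open>The lift of the \<open>i\<close>-th character of the displacement, written as a
    quotient of characters.\<close>
  define Q where "Q = (\<lambda>x. torus_char i (f (torus_proj x)) / torus_char i (torus_proj x))"
  have "continuous_on UNIV (\<lambda>x. torus_char i (torus_proj x))"
    unfolding torus_char_proj cis_conv_exp by (intro continuous_intros)
  then have "continuous_on UNIV Q"
    unfolding Q_def
    by (intro continuous_on_divide smooth_torus_map_char_continuous [OF assms(2)]) auto
  then have closed: "closed {x. Q x = torus_char i (f 0)}"
    by (intro closed_Collect_eq continuous_on_const)
  have "rep_torus p \<in> {x. Q x = torus_char i (f 0)}"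
    unfolding closed_approachable [OF closed, symmetric]
  proof (intro allI impI)
    fix e :: real
    assume "e > 0"
    then obtain t z where z: "torus_proj z = torus_proj (t *\<^sub>R a)" "dist z (rep_torus p) < e"
      using torus_line_dense [OF assms(1)] by blast
    have "f (torus_proj z) = f 0 + torus_proj z"
      using assms(3) [of 0 t] z(1) by simp
    then have "Q z = torus_char i (f 0)"
      by (simp add: Q_def torus_char_add del: torus_char_proj)
    then show "\<exists>y\<in>{x. Q x = torus_char i (f 0)}. dist y (rep_torus p) < e"
      using z(2) by blast
  qed
  then show "torus_char i (f p) = torus_char i (p + f 0)"
    by (simp add: Q_def torus_char_add field_simps del: torus_char_proj)
qed

section \<open>Maps that normalize the line flow scale its direction\<close>

lemma torus_line_inclusion:
  assumes nz: "\<And>i. a $ i \<noteq> 0"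
    and incl: "\<And>t. \<exists>s. torus_proj (t *\<^sub>R v) = torus_proj (s *\<^sub>R a)"
  shows "\<exists>\<alpha>. v = \<alpha> *\<^sub>R a"
proof -
  have cross: "v $ i * a $ j = v $ j * a $ i" for i j
  proof (rule ccontr)
    define d where "d = v $ i * a $ j - v $ j * a $ i"
    assume "v $ i * a $ j \<noteq> v $ j * a $ i"
    then have "d \<noteq> 0"
      by (simp add: d_def)
    \<comment> \<open>Coordinates \<open>i\<close> and \<open>j\<close> of the congruence are two
      equations in \<open>t\<close> and \<open>s\<close> with integer right-hand sides. Eliminating
      \<open>s\<close> leaves \<open>t * d\<close> as a combination of two integers, so with
      \<open>d\<close> nonzero there would be only countably many real \<open>t\<close>.\<close>
    let ?C = "range (\<lambda>(k :: int, l :: int). (of_int k * a $ j - of_int l * a $ i) / d)"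
    have "t \<in> ?C" for t
    proof -
      obtain s where "torus_proj (t *\<^sub>R v) = torus_proj (s *\<^sub>R a)"
        using incl by blast
      then have Z: "t * v $ k - s * a $ k \<in> \<int>" for k
        by (simp add: torus_proj_eq_iff)
      obtain k l where "t * v $ i - s * a $ i = of_int k" "t * v $ j - s * a $ j = of_int l"
        using Z [of i] Z [of j] by (auto elim!: Ints_cases)
      then have "of_int k * a $ j - of_int l * a $ i =
          (t * v $ i - s * a $ i) * a $ j - (t * v $ j - s * a $ j) * a $ i"
        by simp
      also have "\<dots> = t * d"
        by (simp add: d_def algebra_simps)
      finally have "t = (of_int k * a $ j - of_int l * a $ i) / d"
        using \<open>d \<noteq> 0\<close> by (simp add: field_simps)
      then show ?thesis
        by (intro range_eqI [of _ _ "(k, l)"]) simp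
    qed
    then have "(UNIV :: real set) = ?C"
      by blast
    moreover have "countable ?C"
      by simp
    ultimately have "countable (UNIV :: real set)"
      by (rule ssubst)
    then show False
      using uncountable_UNIV_real by blast
  qed
  obtain j :: 'a where True
    by simp
  \<comment> \<open>Any index \<open>j\<close> serves, because by \<open>cross\<close> the vectors
    are proportional.\<close>
  have "v = (v $ j / a $ j) *\<^sub>R a"
    using nz [of j] cross [of _ j] by (simp add: vec_eq_iff field_simps)
  then show ?thesis ..
qed

lemma line_normalizing_map_scales:
  assumes ind: "rational_independent a"
    and R: "smooth_torus_map R" "inj R"
    and norm: "\<And>t. \<exists>s. \<forall>p. R (p + torus_proj (t *\<^sub>R a)) = R p + torus_proj (s *\<^sub>R a)"
  shows "\<exists>\<alpha>. \<alpha> \<noteq> 0 \<and> (\<forall>p. snd (tangent_map R (p, a)) = \<alpha> *\<^sub>R a)"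
proof -
  obtain s where s: "\<And>t p. R (p + torus_proj (t *\<^sub>R a)) = R p + torus_proj (s t *\<^sub>R a)"
    using norm by metis
  define v where "v = snd (tangent_map R (0, a))"
  \<comment> \<open>The function \<open>s\<close> is merely chosen and nothing is known about its
    regularity, so the derivative is taken of the whole character factor. That factor does not
    mention \<open>p\<close>; by uniqueness of derivatives the image of \<open>a\<close> under the
    tangent map cannot depend on \<open>p\<close> either.\<close>
  have deriv: "((\<lambda>t. torus_char i (torus_proj (s t *\<^sub>R a))) has_vector_derivative
      2 * pi * \<i> * of_real (snd (tangent_map R (p, a)) $ i)) (at 0)" for i p
  proof -
    have "((\<lambda>t. torus_char i (R p) * torus_char i (torus_proj (s t *\<^sub>R a))) has_vector_derivative
      torus_char i (R p) * (2 * pi * \<i> * of_real (snd (tangent_map R (p, a)) $ i))) (at 0)"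
      using torus_char_line_derivative [OF R(1), of i p a 0]
      by (simp add: s torus_char_add mult_ac)
    from has_vector_derivative_mult_right [OF this, of "inverse (torus_char i (R p))"]
    show ?thesis
      by (simp flip: mult.assoc)
  qed
  have const: "snd (tangent_map R (p, a)) = v" for p
    using vector_derivative_unique_at [OF deriv deriv] by (simp add: vec_eq_iff v_def)
  then have line: "R (p + torus_proj (t *\<^sub>R a)) = R p + torus_proj (t *\<^sub>R v)" for p t
    by (rule smooth_torus_map_along_line [OF R(1)])
  have "\<exists>u. torus_proj (t *\<^sub>R v) = torus_proj (u *\<^sub>R a)" for t
    using line [of 0 t] s [of 0 t] by auto
  then obtain \<alpha> where \<alpha>: "v = \<alpha> *\<^sub>R a"
    using torus_line_inclusion rational_independent_nonzero [OF ind] by metis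
  have "\<alpha> \<noteq> 0"
  proof
    assume "\<alpha> = 0"
    obtain j :: 'a where True
      by simp
    \<comment> \<open>With \<alpha> zero, \<open>R\<close> would be constant along the line. At this
      time the \<open>j\<close>-th coordinate has moved by 1/2, which is not an integer, so
      injectivity of \<open>R\<close> is violated.\<close>
    define t where "t = 1 / (2 * a $ j)"
    have "R (0 + torus_proj (t *\<^sub>R a)) = R 0"
      using line [of 0 t] \<alpha> \<open>\<alpha> = 0\<close> by simp
    then have "torus_proj (t *\<^sub>R a) = torus_proj 0"
      using R(2) by (simp add: inj_eq)
    then have "t * a $ j \<in> \<int>"
      unfolding torus_proj_eq_iff by simp
    then have "1 / 2 \<in> (\<int> :: real set)"
      using rational_independent_nonzero [OF ind, of j] by (simp add: t_def)
    then show False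
      by (auto elim!: Ints_cases simp: field_simps)
  qed
  then show ?thesis
    using const \<alpha> by auto
qed

section \<open>Translations as diffeomorphisms\<close>

lemma Ck_on_cong:
  assumes "open S" "\<And>x. x \<in> S \<Longrightarrow> f x = g x" "Ck_on k f S"
  shows "Ck_on k g S"
  using assms
proof (induction k arbitrary: f g)
  case 0
  then show ?case
    using continuous_on_cong [OF refl, of S f g] by simp
next
  case (Suc k)
  note eq = Suc.prems(2)
  have f: "f differentiable (at x)" if "x \<in> S" for x
    using Suc.prems(3) that by simp
  have diff: "g differentiable (at x)" if "x \<in> S" for x
    by (rule differentiableI, rule has_derivative_transform_within_open
        [OF f [OF that, unfolded frechet_derivative_works] \<open>open S\<close> that eq])
  have deriv_eq: "frechet_derivative f (at x) v = frechet_derivative g (at x) v" if "x \<in> S" for x v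
    by (rule fun_cong [OF frechet_derivative_transform_within_open
          [OF f [OF that] \<open>open S\<close> that eq]])
  have "Ck_on k (\<lambda>x. frechet_derivative g (at x) v) S" for v
  proof (rule Suc.IH [OF \<open>open S\<close> deriv_eq])
    show "Ck_on k (\<lambda>x. frechet_derivative f (at x) v) S"
      using Suc.prems(3) by simp
  qed
  then show ?case
    using diff by simp
qed

lemma Ck_on_const: "Ck_on k (\<lambda>x. c) S"
  by (induction k arbitrary: c) auto

lemma frechet_derivative_translation: "frechet_derivative (\<lambda>x. x + d) (at x) = (\<lambda>v. v)"
  by (rule frechet_derivative_at [symmetric]) (auto intro!: derivative_eq_intros)

lemma smooth_on_translation: "smooth_on (\<lambda>x. x + d) S"
  unfolding smooth_on_def
proof
  fix k
  show "Ck_on k (\<lambda>x. x + d) S"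
    by (cases k) (auto simp: frechet_derivative_translation Ck_on_const intro!: continuous_intros)
qed

text \<open>The displacement is the difference of the two chart centres, which agrees with a lift of
  \<open>c\<close> only up to the lattice. The radius 1/2 keeps the image inside the open cube
  around \<open>rep_torus (p + c)\<close>, where the chart inverts the projection.\<close>

lemma local_expr_translation:
  assumes "x \<in> ball (rep_torus p) (1/2)"
  shows "local_expr (\<lambda>q. q + c) p x = x + (rep_torus (p + c) - rep_torus p)"
proof -
  let ?y = "x + (rep_torus (p + c) - rep_torus p)"
  have "p + torus_proj ?y = torus_proj (rep_torus p + ?y)"
    by (simp only: torus_proj_add torus_proj_rep)
  also have "rep_torus p + ?y = x + rep_torus (p + c)"
    by simp
  also have "torus_proj \<dots> = p + (torus_proj x + c)"
    by (simp only: torus_proj_add torus_proj_rep add.left_commute)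
  finally have "torus_proj x + c = torus_proj ?y"
    by simp
  moreover have "torus_chart (rep_torus (p + c)) (torus_proj ?y) = ?y"
  proof (rule torus_chart_proj_near)
    fix i
    have "\<bar>(x - rep_torus p) $ i\<bar> < 1/2"
      using assms component_le_norm_cart [of "x - rep_torus p" i]
      by (simp add: dist_norm norm_minus_commute)
    then show "\<bar>?y $ i - rep_torus (p + c) $ i\<bar> < 1/2"
      by simp
  qed
  ultimately show ?thesis
    by (simp add: local_expr_def)
qed

lemma smooth_torus_map_translation: "smooth_torus_map (\<lambda>q. q + c)"
  unfolding smooth_torus_map_def
proof
  fix p
  have "smooth_on (local_expr (\<lambda>q. q + c) p) (ball (rep_torus p) (1/2))"
    unfolding smooth_on_def
  proof
    fix k
    show "Ck_on k (local_expr (\<lambda>q. q + c) p) (ball (rep_torus p) (1/2))"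
      by (rule Ck_on_cong [OF open_ball local_expr_translation [symmetric]])
        (use smooth_on_translation in \<open>auto simp: smooth_on_def\<close>)
  qed
  then show "\<exists>U. open U \<and> rep_torus p \<in> U \<and> smooth_on (local_expr (\<lambda>q. q + c) p) U"
    by (intro exI [of _ "ball (rep_torus p) (1/2)"]) auto
qed

lemma tangent_map_translation: "tangent_map (\<lambda>q. q + c) (p, v) = (p + c, v)"
proof -
  have "frechet_derivative (local_expr (\<lambda>q. q + c) p) (at (rep_torus p))
    = frechet_derivative (\<lambda>x. x + (rep_torus (p + c) - rep_torus p)) (at (rep_torus p))"
    by (rule frechet_derivative_transform_within_open
        [where X = "ball (rep_torus p) (1/2)", symmetric])
      (simp_all add: local_expr_translation)
  then show ?thesis
    by (simp add: tangent_map_def frechet_derivative_translation)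
qed

lemma translation_bij: "bij (\<lambda>q :: 'n::finite torus. q + c)"
  by (rule bij_plus_right)

lemma inv_translation: "inv_into UNIV (\<lambda>q :: 'n::finite torus. q + c) = (\<lambda>q. q + - c)"
  by (rule inv_equality) auto

lemma translation_in_Diff_torus: "(\<lambda>q. q + c) \<in> carrier Diff_torus"
  using translation_bij
  by (simp add: Diff_torus_def inv_translation smooth_torus_map_translation
      del: add_uminus_conv_diff)

section \<open>Normalizer and multiplier in concrete terms\<close>

lemma m_inv_Diff_torus:
  assumes "f \<in> carrier Diff_torus"
  shows "inv\<^bsub>Diff_torus\<^esub> f = inv_into UNIV f"
proof -
  have f: "bij f" "smooth_torus_map f" "smooth_torus_map (inv_into UNIV f)"
    using assms by (auto simp: Diff_torus_def)
  show ?thesis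
    unfolding m_inv_def
  proof (rule the_equality)
    show "inv_into UNIV f \<in> carrier Diff_torus \<and>
      f \<otimes>\<^bsub>Diff_torus\<^esub> inv_into UNIV f = \<one>\<^bsub>Diff_torus\<^esub> \<and>
      inv_into UNIV f \<otimes>\<^bsub>Diff_torus\<^esub> f = \<one>\<^bsub>Diff_torus\<^esub>"
      using f by (auto simp: Diff_torus_def bij_imp_bij_inv inv_inv_eq bij_is_surj bij_is_inj
          surj_iff [symmetric])
  next
    fix g
    assume "g \<in> carrier Diff_torus \<and> f \<otimes>\<^bsub>Diff_torus\<^esub> g = \<one>\<^bsub>Diff_torus\<^esub> \<and>
      g \<otimes>\<^bsub>Diff_torus\<^esub> f = \<one>\<^bsub>Diff_torus\<^esub>"
    then show "g = inv_into UNIV f"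
      by (intro inv_unique_comp [symmetric]) (auto simp: Diff_torus_def)
  qed
qed

text \<open>\<open>normalizer\<close> is a stabilizer under conjugation of subsets, expressed by
  cosets and the abstract group inverse. Here it becomes conjugation of each member by the inverse
  function.\<close>

lemma normalizer_Diff_torus_iff:
  assumes "F \<subseteq> carrier Diff_torus"
  shows "R \<in> normalizer Diff_torus F \<longleftrightarrow>
    R \<in> carrier Diff_torus \<and> (\<lambda>f. R \<circ> f \<circ> inv_into UNIV R) ` F = F"
proof -
  have "R <#\<^bsub>Diff_torus\<^esub> F #>\<^bsub>Diff_torus\<^esub> inv\<^bsub>Diff_torus\<^esub> R = (\<lambda>f. R \<circ> f \<circ> inv_into UNIV R) ` F"
    if "R \<in> carrier Diff_torus"
    unfolding m_inv_Diff_torus [OF that] by (auto simp: l_coset_def r_coset_def Diff_torus_def)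
  then show ?thesis
    using assms by (auto simp: normalizer_def stabilizer_def)
qed

text \<open>The pushforward evaluates the tangent map at preimages; as \<open>R\<close> is
  bijective, these run through all points.\<close>

lemma pushforward_constant_field_eq_iff:
  assumes "bij R"
  shows "pushforward R (constant_field a) = scale_field \<alpha> (constant_field a) \<longleftrightarrow>
    (\<forall>p. snd (tangent_map R (p, a)) = \<alpha> *\<^sub>R a)"
proof -
  have "pushforward R (constant_field a) = scale_field \<alpha> (constant_field a) \<longleftrightarrow>
    (\<forall>q. snd (tangent_map R (inv_into UNIV R q, a)) = \<alpha> *\<^sub>R a)"
    using assms
    by (auto simp: fun_eq_iff pushforward_def scale_field_def constant_field_def tangent_map_def
        bij_is_surj surj_f_inv_f)
  also have "\<dots> \<longleftrightarrow> (\<forall>p. snd (tangent_map R (p, a)) = \<alpha> *\<^sub>R a)"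
    using assms by (metis bij_inv_eq_iff)
  finally show ?thesis .
qed

text \<open>A nonzero \<open>a\<close> determines the scalar, so the definite description in
  \<open>multiplier\<close> denotes it.\<close>

lemma multiplier_constant_field_eqI:
  assumes "bij R" "a \<noteq> 0" "\<alpha> \<noteq> 0" "\<And>p. snd (tangent_map R (p, a)) = \<alpha> *\<^sub>R a"
  shows "multiplier (constant_field a) R = \<alpha>"
  unfolding multiplier_def pushforward_constant_field_eq_iff [OF assms(1)]
  by (rule the_equality) (use assms in auto)

section \<open>The kernel is the group of translations\<close>

lemma multiplier_kernel_constant_field:
  fixes a :: "real^'n::finite"
  assumes ind: "rational_independent a"
    and flow: "flow_generated_by (constant_field a) \<phi>"
  shows "carrier (multiplier_kernel_group (constant_field a) \<phi>) = range (\<lambda>c q. q + c)"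
proof -
  have \<phi>: "\<phi> = (\<lambda>t p. p + torus_proj (t *\<^sub>R a))"
    using flow_of_constant_field [OF flow] by blast
  then have F: "range \<phi> \<subseteq> carrier Diff_torus"
    using translation_in_Diff_torus by auto
  have "a \<noteq> 0"
    using rational_independent_nonzero [OF ind] by auto
  have carrier: "R \<in> carrier (multiplier_kernel_group (constant_field a) \<phi>) \<longleftrightarrow>
    R \<in> carrier Diff_torus \<and> (\<lambda>f. R \<circ> f \<circ> inv_into UNIV R) ` range \<phi> = range \<phi> \<and>
    multiplier (constant_field a) R = 1" for R
    by (simp add: multiplier_kernel_group_def kernel_def flow_normalizer_group_def
        mult_real_group_def normalizer_Diff_torus_iff [OF F])
  show ?thesis
  proof (intro equalityI subsetI)
    fix R
    assume "R \<in> carrier (multiplier_kernel_group (constant_field a) \<phi>)"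
    then have R: "bij R" "smooth_torus_map R"
      and norm: "(\<lambda>f. R \<circ> f \<circ> inv_into UNIV R) ` range \<phi> = range \<phi>"
      and mult: "multiplier (constant_field a) R = 1"
      unfolding carrier by (auto simp: Diff_torus_def)
    have "\<exists>s. \<forall>p. R (p + torus_proj (t *\<^sub>R a)) = R p + torus_proj (s *\<^sub>R a)" for t
    proof -
      have "R \<circ> \<phi> t \<circ> inv_into UNIV R \<in> range \<phi>"
        using norm by blast
      then obtain s where s: "R \<circ> \<phi> t \<circ> inv_into UNIV R = \<phi> s"
        by blast
      have "R (\<phi> t p) = \<phi> s (R p)" for p
        using fun_cong [OF s, of "R p"] R(1) by (simp add: bij_is_inj)
      then show ?thesis
        by (auto simp: \<phi>)
    qed
    then obtain \<alpha> where \<alpha>: "\<alpha> \<noteq> 0" "\<And>p. snd (tangent_map R (p, a)) = \<alpha> *\<^sub>R a"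
      using line_normalizing_map_scales [OF ind R(2)] R(1) by (blast dest: bij_is_inj)
    then have "\<alpha> = 1"
      using multiplier_constant_field_eqI [OF R(1) \<open>a \<noteq> 0\<close>] mult by auto
    then have "R (p + torus_proj (t *\<^sub>R a)) = R p + torus_proj (t *\<^sub>R a)" for p t
      using smooth_torus_map_along_line [OF R(2)] \<alpha>(2) by simp
    then have "R = (\<lambda>q. q + R 0)"
      using smooth_torus_map_commuting_with_line [OF ind R(2)] by blast
    then show "R \<in> range (\<lambda>c q. q + c)"
      by blast
  next
    fix R :: "'n torus \<Rightarrow> 'n torus"
    assume "R \<in> range (\<lambda>c q. q + c)"
    then obtain c where R: "R = (\<lambda>q. q + c)"
      by blast
    \<comment> \<open>The flow maps are translations too, and translations commute, so conjugation
      by \<open>R\<close> fixes each of them individually.\<close>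
    have "R \<circ> f \<circ> inv_into UNIV R = f" if "f \<in> range \<phi>" for f
      using that by (auto simp: R inv_translation \<phi> fun_eq_iff)
    then have "(\<lambda>f. R \<circ> f \<circ> inv_into UNIV R) ` range \<phi> = range \<phi>"
      by simp
    moreover have "multiplier (constant_field a) R = 1"
      by (rule multiplier_constant_field_eqI)
        (use \<open>a \<noteq> 0\<close> translation_bij in \<open>auto simp: R tangent_map_translation\<close>)
    ultimately show "R \<in> carrier (multiplier_kernel_group (constant_field a) \<phi>)"
      unfolding carrier using translation_in_Diff_torus R by blast
  qed
qed

theorem corollary4p7:
  fixes a :: "real^'n::finite"
    and \<phi> :: "real \<Rightarrow> 'n torus \<Rightarrow> 'n torus"
  assumes "CARD('n) \<ge> 2"
    and "rational_independent a"
    and "flow_generated_by (constant_field a) \<phi>"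
  shows "multiplier_kernel_group (constant_field a) \<phi> \<cong> (torus_group :: 'n torus monoid)"
proof -
  let ?K = "multiplier_kernel_group (constant_field a) \<phi>"
  have carrier: "carrier ?K = range (\<lambda>c q. q + c)"
    using multiplier_kernel_constant_field [OF assms(2,3)] .
  \<comment> \<open>Evaluation at 0 recovers the constant of a translation. Composition adds the
    constants, in an order that does not matter since the torus is abelian.\<close>
  have "(\<lambda>R. R 0) \<in> iso ?K torus_group"
  proof (rule isoI)
    show "(\<lambda>R. R 0) \<in> hom ?K torus_group"
      unfolding hom_def carrier
      by (auto simp: torus_group_def multiplier_kernel_group_def flow_normalizer_group_def
          Diff_torus_def add.commute)
    show "bij_betw (\<lambda>R. R 0) (carrier ?K) (carrier torus_group)"
      unfolding carrier by (auto simp: torus_group_def bij_betw_def inj_on_def image_image)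
  qed
  then show ?thesis
    by (auto simp: is_iso_def)
qed

end
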